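(* Let $m,n$ be positive integers and let $q,c\in\mathbb{C}$ with $q\neq 0$. If $m>n=1$ or $n>m=1$, then the equation $$w'(z)^{n}+w(qz+c)^{m}=1$$ has no transcendental entire solution of order zero.
   Context: The order of an entire function $w$ is $\rho(w)=\limsup_{r\to\infty}\frac{\log^{+}T(r,w)}{\log r}$, where $T(r,w)$ is the Nevanlinna characteristic function. "Order zero" means $\rho(w)=0$. An entire function is transcendental if it is not a polynomial. *)

theory Defs
  imports "HOL-Complex_Analysis.Complex_Analysis"
begin

definition log_plus :: "real \<Rightarrow> real" where
  "log_plus x = ln (max 1 x)"

text \<open>The functions \<open>m(r, f)\<close>, \<open>n(r, f)\<close>, \<open>N(r, f)\<close> and \<open>T(r, f)\<close> of Nevanlinna theory, for
  \<open>f\<close> meromorphic in the plane and \<open>r > 0\<close>.\<close>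

definition proximity_fun :: "(complex \<Rightarrow> complex) \<Rightarrow> real \<Rightarrow> real" where
  "proximity_fun f r =
     1 / (2 * pi) * integral {0..2 * pi} (\<lambda>t. log_plus (cmod (f (of_real r * cis t))))"

text \<open>At a pole, \<open>zorder\<close> is minus the multiplicity.\<close>

definition pole_count :: "(complex \<Rightarrow> complex) \<Rightarrow> real \<Rightarrow> real" where
  "pole_count f r = (\<Sum>z | cmod z \<le> r \<and> is_pole f z. real_of_int (- zorder f z))"

definition pole_counting_fun :: "(complex \<Rightarrow> complex) \<Rightarrow> real \<Rightarrow> real" where
  "pole_counting_fun f r =
     integral {0..r} (\<lambda>t. (pole_count f t - pole_count f 0) / t) + pole_count f 0 * ln r"

definition nevanlinna_char :: "(complex \<Rightarrow> complex) \<Rightarrow> real \<Rightarrow> real" where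
  "nevanlinna_char f r = proximity_fun f r + pole_counting_fun f r"

definition growth_order :: "(complex \<Rightarrow> complex) \<Rightarrow> ereal" where
  "growth_order f = Limsup at_top (\<lambda>r. ereal (log_plus (nevanlinna_char f r) / ln r))"

definition transcendental_entire :: "(complex \<Rightarrow> complex) \<Rightarrow> bool" where
  "transcendental_entire f \<longleftrightarrow>
     f holomorphic_on UNIV \<and> \<not> (\<exists>p :: complex poly. \<forall>z. f z = poly p z)"

lemma nevanlinna_char_entire:
  assumes "f holomorphic_on UNIV"
  shows "nevanlinna_char f r = proximity_fun f r"
proof -
  have "\<not> is_pole f z" for z
    using assms not_is_pole_holomorphic[of UNIV z f] by auto
  then show ?thesis
    by (simp add: nevanlinna_char_def pole_counting_fun_def pole_count_def)
qed

end

theory Submission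
  imports Defs
begin

text \<open>
  Let \<open>M(r)\<close> be the maximum modulus of \<open>w\<close>. Cauchy's estimate (for \<open>n = 1\<close>) or integration of
  \<open>w'\<close> (for \<open>m = 1\<close>) turns the equation into \<open>M(r)\<^sup>2 \<le> C r\<^sup>2 M(K r)\<close> for some \<open>K > 1\<close>. As \<open>w\<close> is
  transcendental, \<open>M\<close> beats every power of \<open>r\<close>, so \<open>(3/2) log M(r) \<le> log M(K r)\<close> for large \<open>r\<close>;
  iterating this gives \<open>log M\<close> positive order.

  It remains to bound \<open>log\<^sup>+ M(r)\<close> by \<open>3 T(2r, w)\<close>. On the circle, \<open>log\<^sup>+ |w|\<close> is uniformly close
  from below to \<open>Re A\<close> for an entire \<open>A\<close>, by the Stone-Weierstrass theorem. The maximum principle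
  for \<open>w exp(-A)\<close> gives \<open>log\<^sup>+ |w| \<le> Re A\<close> inside, Harnack's inequality bounds \<open>Re A\<close> on the
  half disc by \<open>3 Re A(0)\<close>, and \<open>Re A(0)\<close> is the mean of \<open>Re A\<close> over the circle.
\<close>

section \<open>Bounding log^+ |f| on a half disc by its circle mean\<close>

lemma log_plus_nonneg: "0 \<le> log_plus x"
  by (simp add: log_plus_def)

lemma continuous_on_log_plus_cmod:
  assumes "continuous_on S f"
  shows "continuous_on S (\<lambda>z. log_plus (cmod (f z)))"
  unfolding log_plus_def by (intro continuous_intros assms) auto

text \<open>Since cnj z = 1/z on the unit circle, a real linear form in z is a Laurent polynomial
  there, and Laurent polynomials are closed under sums and products. Dividing by
  \<open>z ^ N\<close> supplies the negative powers.\<close>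

lemma real_polynomial_function_on_unit_circle:
  fixes g :: "complex \<Rightarrow> real"
  assumes "real_polynomial_function g"
  shows "\<exists>p N. \<forall>z\<in>sphere 0 1. complex_of_real (g z) = poly p z / z ^ N"
  using assms
proof induction
  case (linear f)
  interpret bounded_linear f by fact
  \<comment> \<open>Chosen so that Re z * f(1) + Im z * f(i) = 2 Re (cnj b * z) = b * cnj z + cnj b
    * z.\<close>
  define b where "b = (Complex (f 1) (f \<i>)) / 2"
  have "complex_of_real (f z) = poly [:b, 0, cnj b:] z / z ^ 1" if "z \<in> sphere 0 1" for z
  proof -
    have z: "z \<noteq> 0" "1 / z = cnj z"
      using that complex_norm_square[of z] by (auto simp: divide_eq_eq mult.commute)
    have "f z = f (Re z *\<^sub>R 1 + Im z *\<^sub>R \<i>)"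
      by (rule arg_cong[where f = f]) (simp add: complex_eq_iff)
    also have "\<dots> = Re z * f 1 + Im z * f \<i>"
      by (simp only: add scale) simp
    finally have "complex_of_real (f z) = b * cnj z + cnj b * z"
      by (simp add: complex_eq_iff b_def field_simps)
    also have "\<dots> = poly [:b, 0, cnj b:] z / z ^ 1"
      using z(1) by (simp add: field_simps flip: z(2))
    finally show ?thesis .
  qed
  then show ?case by blast
next
  case (const c)
  show ?case by (rule exI[of _ "[:of_real c:]"], rule exI[of _ 0]) simp
next
  case (add f g)
  then obtain p N q M where "\<forall>z\<in>sphere 0 1. complex_of_real (f z) = poly p z / z ^ N"
      "\<forall>z\<in>sphere 0 1. complex_of_real (g z) = poly q z / z ^ M" by blast
  moreover have nz: "z \<noteq> 0" if "cmod z = 1" for z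
    using that by auto
  ultimately have "\<forall>z\<in>sphere 0 1. complex_of_real (f z + g z) =
      poly (p * monom 1 M + q * monom 1 N) z / z ^ (N + M)"
    by (auto simp: poly_monom add_divide_distrib power_add nz)
  then show ?case by blast
next
  case (mult f g)
  then obtain p N q M where "\<forall>z\<in>sphere 0 1. complex_of_real (f z) = poly p z / z ^ N"
      "\<forall>z\<in>sphere 0 1. complex_of_real (g z) = poly q z / z ^ M" by blast
  then have "\<forall>z\<in>sphere 0 1. complex_of_real (f z * g z) = poly (p * q) z / z ^ (N + M)"
    by (auto simp: power_add)
  then show ?case by blast
qed

text \<open>On the unit circle \<open>Re (a / z ^ k) = Re (cnj a * z ^ k)\<close>, so the negative powers of a
  Laurent polynomial can be reflected.\<close>

lemma real_polynomial_function_eq_Re_holomorphic: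
  fixes g :: "complex \<Rightarrow> real"
  assumes "real_polynomial_function g"
  obtains A where "A holomorphic_on UNIV" "\<And>z. z \<in> sphere 0 1 \<Longrightarrow> g z = Re (A z)"
proof -
  obtain p N where p: "\<forall>z\<in>sphere 0 1. complex_of_real (g z) = poly p z / z ^ N"
    using real_polynomial_function_on_unit_circle[OF assms] by blast
  define A where "A z = (\<Sum>k\<le>degree p. if k < N then cnj (coeff p k) * z ^ (N - k)
      else coeff p k * z ^ (k - N))" for z
  have "A holomorphic_on UNIV"
    unfolding A_def
  proof (rule holomorphic_on_sum)
    show "(\<lambda>z. if k < N then cnj (coeff p k) * z ^ (N - k) else coeff p k * z ^ (k - N))
        holomorphic_on UNIV" for k
      by (cases "k < N") (simp_all add: holomorphic_intros)
  qed
  moreover have "g z = Re (A z)" if "z \<in> sphere 0 1" for z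
  proof -
    have z: "z \<noteq> 0" "1 / z = cnj z"
      using that complex_norm_square[of z] by (auto simp: divide_eq_eq mult.commute)
    have "Re (coeff p k * z ^ k / z ^ N) = Re (if k < N then cnj (coeff p k) * z ^ (N - k)
      else coeff p k * z ^ (k - N))" for k
    proof (cases "k < N")
      case True
      then have "z ^ N = z ^ k * z ^ (N - k)"
        by (simp flip: power_add)
      then have "coeff p k * z ^ k / z ^ N = coeff p k * (1 / z) ^ (N - k)"
        using z(1) by (simp add: field_simps)
      also have "\<dots> = cnj (cnj (coeff p k) * z ^ (N - k))"
        by (simp add: z(2))
      finally show ?thesis using True by (simp only: cnj.simps if_True)
    next
      case False
      then have "z ^ k = z ^ N * z ^ (k - N)"
        by (simp flip: power_add)
      then show ?thesis using z(1) False by simp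
    qed
    then have "Re (poly p z / z ^ N) = Re (A z)"
      unfolding poly_altdef A_def sum_divide_distrib Re_sum by (intro sum.cong) auto
    then show ?thesis using bspec[OF p that, symmetric] by simp
  qed
  ultimately show ?thesis using that by blast
qed

text \<open>This is Cauchy's integral formula at the centre, where du/u = i dt on the unit
  circle.\<close>

lemma circle_mean_value_Re:
  assumes "A holomorphic_on UNIV"
  shows "((\<lambda>t. Re (A (cis t))) has_integral 2 * pi * Re (A 0)) {0..2 * pi}"
proof -
  have "((\<lambda>u. A u / (u - 0)) has_contour_integral (2 * of_real pi * \<i> * A 0)) (circlepath 0 1)"
    by (rule Cauchy_integral_circlepath)
       (use assms in \<open>auto intro!: holomorphic_on_imp_continuous_on intro: holomorphic_on_subset\<close>)
  then have "((\<lambda>t. A (cis t) / cis t * (\<i> * cis t)) has_integral (2 * of_real pi * \<i> * A 0)) {0..2*pi}"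
    by (simp add: circlepath_def has_contour_integral_part_circlepath_iff mult_ac)
  then have "((\<lambda>t. \<i> * A (cis t)) has_integral (\<i> * (2 * of_real pi * A 0))) {0..2*pi}"
    by (simp add: mult_ac)
  from has_integral_mult_right[OF this, of "-\<i>"]
  have "((\<lambda>t. A (cis t)) has_integral (2 * of_real pi * A 0)) {0..2*pi}"
    by (simp flip: mult.assoc)
  from has_integral_Re[OF this] show ?thesis by simp
qed

text \<open>The Cayley-type map \<open>h\<close> carries the right half plane to the unit disc and
  the value \<open>A 0\<close> to 0, so the Schwarz lemma applies. The constant 3 is (1 + 1/2) / (1
  - 1/2).\<close>

lemma harnack_half_disc:
  assumes A: "A holomorphic_on UNIV" and pos: "\<And>z. z \<in> ball 0 1 \<Longrightarrow> Re (A z) > 0"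
    and a: "cmod a \<le> 1/2"
  shows "Re (A a) \<le> 3 * Re (A 0)"
proof -
  define h where "h z = (A z - A 0) / (A z + cnj (A 0))" for z
  have nz: "A z + cnj (A 0) \<noteq> 0" if "z \<in> ball 0 1" for z
    using pos[OF that] pos[of 0] by (auto simp: complex_eq_iff)
  have "cmod (h a) \<le> cmod a"
  proof (rule Schwarz_Lemma(1))
    show "h holomorphic_on ball 0 1"
      unfolding h_def using nz by (intro holomorphic_intros holomorphic_on_subset[OF A]) auto
    show "cmod (h z) < 1" if "cmod z < 1" for z
    proof -
      \<comment> \<open>The two squared moduli compared next differ by exactly four times this
        product.\<close>
      have "Re (A z) * Re (A 0) > 0" using pos[of z] pos[of 0] that by simp
      then have "cmod (A z - A 0) ^ 2 < cmod (A z + cnj (A 0)) ^ 2"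
        unfolding cmod_power2 by (simp add: power2_eq_square algebra_simps)
      then have "cmod (A z - A 0) < cmod (A z + cnj (A 0))"
        by (rule power_less_imp_less_base) simp
      then show ?thesis using nz[of z] that by (simp add: h_def norm_divide)
    qed
  qed (use a in \<open>auto simp: h_def\<close>)
  with a have "cmod (h a) \<le> 1/2" by simp
  then have "cmod (A a - A 0) \<le> 1/2 * cmod (A a + cnj (A 0))"
    using nz[of a] a by (simp add: h_def norm_divide field_simps)
  \<comment> \<open>Written this way, half of |A a - A 0| can be absorbed into the left-hand
    side.\<close>
  also have "A a + cnj (A 0) = (A a - A 0) + of_real (2 * Re (A 0))"
    by (simp add: complex_eq_iff)
  also have "cmod \<dots> \<le> cmod (A a - A 0) + 2 * Re (A 0)"
    using pos[of 0] norm_triangle_ineq[of "A a - A 0" "of_real (2 * Re (A 0))"] by (simp add: norm_mult)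
  finally have "cmod (A a - A 0) \<le> 2 * Re (A 0)" by simp
  then show ?thesis using complex_Re_le_cmod[of "A a - A 0"] by simp
qed

lemma max_principle_unit_disc:
  assumes "f holomorphic_on UNIV" "\<And>z. z \<in> sphere 0 1 \<Longrightarrow> cmod (f z) \<le> B" "z \<in> cball 0 1"
  shows "cmod (f z) \<le> B"
proof (rule maximum_modulus_frontier[of f "cball 0 1"])
  show "f holomorphic_on interior (cball 0 1)" "continuous_on (closure (cball 0 1)) f"
    using assms(1) holomorphic_on_subset holomorphic_on_imp_continuous_on by blast+
qed (use assms in \<open>auto simp: frontier_cball\<close>)

lemma log_plus_le_circle_mean:
  assumes f: "f holomorphic_on UNIV" and a: "cmod a \<le> 1/2"
  shows "log_plus (cmod (f a)) \<le> 3 * (1 / (2 * pi) * integral {0..2*pi} (\<lambda>t. log_plus (cmod (f (cis t)))))"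
    (is "_ \<le> 3 * ?m")
proof (rule field_le_epsilon)
  fix d :: real assume "d > 0"
  \<comment> \<open>The mean of Re A exceeds that of \<open>u\<close> by at most 3e, and Harnack's
    inequality triples this error.\<close>
  define e where "e = d / 9"
  have e: "e > 0" using \<open>d > 0\<close> by (simp add: e_def)
  define u where "u z = log_plus (cmod (f z))" for z
  have contu: "continuous_on S u" for S
    unfolding u_def using f
    by (intro continuous_on_log_plus_cmod holomorphic_on_imp_continuous_on) (auto intro: holomorphic_on_subset)
  \<comment> \<open>Approximating u + 2e within e puts Re A between u + e and u + 3e on the circle:
    a strict majorant of \<open>u\<close>, hence also bounded below by e.\<close>
  obtain g where "real_polynomial_function g"
      and g: "\<And>z. z \<in> sphere 0 1 \<Longrightarrow> \<bar>(u z + 2 * e) - g z\<bar> < e"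
  proof (rule Stone_Weierstrass_real_polynomial_function)
    show "continuous_on (sphere 0 1) (\<lambda>z. u z + 2 * e)" by (intro continuous_intros contu)
  qed (use e that in auto)
  then obtain A where A: "A holomorphic_on UNIV" and gA: "\<And>z. z \<in> sphere 0 1 \<Longrightarrow> g z = Re (A z)"
    using real_polynomial_function_eq_Re_holomorphic by blast
  have lower: "u z + e \<le> Re (A z)" and upper: "Re (A z) \<le> u z + 3 * e" if "z \<in> sphere 0 1" for z
    using g[OF that] gA[OF that] by auto
  have u0: "u z \<ge> 0" for z by (simp add: u_def log_plus_nonneg)
  \<comment> \<open>Minimum principle for Re A, read off from |exp(-A)| = exp(-Re A).\<close>
  have pos: "Re (A z) > 0" if "z \<in> cball 0 1" for z
  proof -
    have "cmod (exp (- A z)) \<le> exp (- e)"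
    proof (rule max_principle_unit_disc[where f = "\<lambda>z. exp (- A z)"])
      show "(\<lambda>z. exp (- A z)) holomorphic_on UNIV" by (intro holomorphic_intros A)
      show "cmod (exp (- A z)) \<le> exp (- e)" if "z \<in> sphere 0 1" for z
        using lower[OF that] u0[of z] by simp
    qed (rule that)
    with e show ?thesis by simp
  qed
  have fu: "cmod (f z) \<le> exp (u z)" for z
    by (simp add: u_def log_plus_def)
  \<comment> \<open>Using the entire function f exp(-A) instead of log |f| - Re A avoids trouble at
    the zeros of \<open>f\<close>.\<close>
  have "cmod (f a * exp (- A a)) \<le> 1"
  proof (rule max_principle_unit_disc[where f = "\<lambda>z. f z * exp (- A z)"])
    show "(\<lambda>z. f z * exp (- A z)) holomorphic_on UNIV" by (intro holomorphic_intros f A)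
    show "cmod (f z * exp (- A z)) \<le> 1" if "z \<in> sphere 0 1" for z
    proof -
      have "cmod (f z * exp (- A z)) \<le> exp (u z) * exp (- Re (A z))"
        using fu[of z] by (simp add: norm_mult)
      also have "\<dots> \<le> 1" using lower[OF that] e by (simp flip: exp_add)
      finally show ?thesis .
    qed
  qed (use a in auto)
  then have "cmod (f a) \<le> exp (Re (A a))"
    by (simp add: exp_minus norm_divide field_simps)
  \<comment> \<open>Positivity of Re A covers the truncation in log^+, that is, the case |f a| <
    1.\<close>
  then have "u a \<le> Re (A a)"
    using pos[of a] a ln_mono[of "max 1 (cmod (f a))" "exp (Re (A a))"]
    by (simp add: u_def log_plus_def)
  also have "\<dots> \<le> 3 * Re (A 0)"
    using harnack_half_disc[OF A _ a] pos by auto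
  also have "Re (A 0) \<le> ?m + 3 * e"
  proof -
    have contc: "continuous_on {0..2*pi} (\<lambda>t. u (cis t))"
      by (rule continuous_on_compose2[OF contu[of UNIV]]) (auto intro!: continuous_intros)
    have int: "((\<lambda>t. u (cis t)) has_integral integral {0..2*pi} (\<lambda>t. u (cis t))) {0..2*pi}"
      using contc by (intro integrable_integral integrable_continuous_interval)
    have "((\<lambda>t. u (cis t) + 3 * e) has_integral (integral {0..2*pi} (\<lambda>t. u (cis t)) + 2 * pi * (3 * e))) {0..2*pi}"
      using has_integral_add[OF int has_integral_const_real[of "3 * e" 0 "2*pi"]] by simp
    from has_integral_le[OF circle_mean_value_Re[OF A] this]
    have "2 * pi * Re (A 0) \<le> integral {0..2*pi} (\<lambda>t. u (cis t)) + 2 * pi * (3 * e)"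
      using upper by auto
    then show ?thesis by (simp add: u_def field_simps)
  qed
  finally show "log_plus (cmod (f a)) \<le> 3 * ?m + d"
    by (simp add: u_def e_def)
qed

text \<open>Rescaling by 2r moves the disc of radius r to the half disc; an entire function has no
  poles, so its characteristic is just the circle mean.\<close>

lemma log_plus_le_nevanlinna_char:
  assumes f: "f holomorphic_on UNIV" and r: "r > 0" and a: "cmod a \<le> r"
  shows "log_plus (cmod (f a)) \<le> 3 * nevanlinna_char f (2 * r)"
proof -
  have "(\<lambda>z. f (of_real (2 * r) * z)) holomorphic_on UNIV"
    using holomorphic_on_compose_gen[of "\<lambda>z. of_real (2*r) * z" UNIV f UNIV] f
    by (auto simp: o_def intro!: holomorphic_intros)
  from log_plus_le_circle_mean[OF this, of "a / of_real (2 * r)"] show ?thesis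
    using r a by (simp add: nevanlinna_char_entire[OF f] proximity_fun_def norm_divide norm_mult field_simps)
qed

section \<open>Maximum modulus of entire functions\<close>

definition max_modulus :: "(complex \<Rightarrow> complex) \<Rightarrow> real \<Rightarrow> real" where
  "max_modulus f r = (SUP z\<in>cball 0 r. cmod (f z))"

lemma cmod_le_max_modulus:
  assumes "f holomorphic_on UNIV" "cmod z \<le> r"
  shows "cmod (f z) \<le> max_modulus f r"
  unfolding max_modulus_def
proof (rule cSUP_upper)
  have "compact ((\<lambda>z. cmod (f z)) ` cball 0 r)"
    using assms(1) by (intro compact_continuous_image continuous_intros holomorphic_on_imp_continuous_on)
      (auto intro: holomorphic_on_subset)
  then show "bdd_above ((\<lambda>z. cmod (f z)) ` cball 0 r)"
    by (intro bounded_imp_bdd_above compact_imp_bounded)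
qed (use assms in auto)

lemma max_modulus_least:
  assumes "r \<ge> 0" "\<And>z. cmod z \<le> r \<Longrightarrow> cmod (f z) \<le> B"
  shows "max_modulus f r \<le> B"
  unfolding max_modulus_def by (rule cSUP_least) (use assms in auto)

text \<open>No maximum principle enters, because the supremum in \<open>max_modulus\<close> runs
  over the closed disc and not over the circle.\<close>

lemma max_modulus_mono:
  assumes "f holomorphic_on UNIV" "0 \<le> r" "r \<le> s"
  shows "max_modulus f r \<le> max_modulus f s"
  using assms by (intro max_modulus_least cmod_le_max_modulus) auto

lemma cmod_deriv_le_max_modulus:
  assumes f: "f holomorphic_on UNIV" and u: "cmod u \<le> r"
  shows "cmod (deriv f u) \<le> max_modulus f (r + 1)"
proof -
  have "cmod ((deriv ^^ 1) f u) \<le> fact 1 * max_modulus f (r + 1) / 1 ^ 1"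
  proof (rule Cauchy_inequality)
    show "f holomorphic_on ball u 1" "continuous_on (cball u 1) f"
      using f holomorphic_on_subset holomorphic_on_imp_continuous_on by blast+
    fix z assume "cmod (u - z) = 1"
    then have "cmod z \<le> r + 1" using u norm_triangle_ineq4[of u "u - z"] by simp
    then show "cmod (f z) \<le> max_modulus f (r + 1)" by (rule cmod_le_max_modulus[OF f])
  qed simp
  then show ?thesis by simp
qed

text \<open>Some Taylor coefficient of index k > d is nonzero, as otherwise the power series would
  be a polynomial; Cauchy's inequality for it gives a r^k \<le> M(r).\<close>

lemma max_modulus_ge_power:
  assumes "transcendental_entire f"
  shows "\<forall>\<^sub>F r in at_top. r ^ d \<le> max_modulus f r"
proof -
  have f: "f holomorphic_on UNIV" and np: "\<And>p. \<not> (\<forall>z. f z = poly p z)"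
    using assms by (auto simp: transcendental_entire_def)
  obtain k where k: "k > d" "(deriv ^^ k) f 0 \<noteq> 0"
  proof (rule ccontr)
    assume "\<not> thesis"
    with that have *: "(deriv ^^ k) f 0 = 0" if "k > d" for k using \<open>k > d\<close> by blast
    have "f z = poly (\<Sum>k\<le>d. monom ((deriv ^^ k) f 0 / fact k) k) z" for z
    proof -
      have "(\<lambda>k. (deriv ^^ k) f 0 / fact k * (z - 0) ^ k) sums f z"
        by (rule holomorphic_power_series[of f 0 "cmod z + 1"]) (use f holomorphic_on_subset in auto)
      moreover have "(\<lambda>k. (deriv ^^ k) f 0 / fact k * (z - 0) ^ k) sums
          (\<Sum>k\<le>d. (deriv ^^ k) f 0 / fact k * (z - 0) ^ k)"
        by (rule sums_finite) (use * in auto)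
      ultimately show ?thesis
        by (simp add: poly_sum poly_monom sums_iff)
    qed
    with np show False by blast
  qed
  define a where "a = cmod ((deriv ^^ k) f 0) / fact k"
  have a: "a > 0" using k by (simp add: a_def)
  \<comment> \<open>Beyond this radius a r \<ge> 1, so one surplus power of r absorbs the small
    constant \<open>a\<close>.\<close>
  have "\<forall>\<^sub>F r in at_top. r \<ge> max 1 (1 / a)" by (rule eventually_ge_at_top)
  then show ?thesis
  proof eventually_elim
    case (elim r)
    then have r: "r \<ge> 1" "a * r \<ge> 1" using a by (auto simp: field_simps)
    have "cmod ((deriv ^^ k) f 0) \<le> fact k * max_modulus f r / r ^ k"
    proof (rule Cauchy_inequality)
      show "f holomorphic_on ball 0 r" "continuous_on (cball 0 r) f"
        using f holomorphic_on_subset holomorphic_on_imp_continuous_on by blast+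
    qed (use r in \<open>auto intro: cmod_le_max_modulus[OF f]\<close>)
    then have "a * r ^ k \<le> max_modulus f r"
      using r by (simp add: a_def field_simps)
    moreover have "r ^ d \<le> (a * r) * r ^ d" using r by simp
    moreover have "a * r ^ Suc d \<le> a * r ^ k"
      using k a r by (intro mult_left_mono power_increasing) auto
    ultimately show ?case by (simp add: mult_ac)
  qed
qed

section \<open>Positive order from growth of the maximum modulus\<close>

lemma filterlim_power_at_top:
  fixes x :: real
  assumes "x > 1"
  shows "filterlim (\<lambda>n. x ^ n) at_top sequentially"
proof (rule filterlim_at_infinity_imp_filterlim_at_top)
  show "filterlim (\<lambda>n. x ^ n) at_infinity sequentially"
    using assms by (intro filterlim_realpow_sequentially_gt1) simp
qed (use assms in simp)

text \<open>Iteration makes log^+ M grow at least like r^(ln \<kappa> / ln K) along the radii K^n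
  r1, whereas order zero bounds T, and with it log^+ M, by any small power of r.\<close>

lemma growth_order_nonzero_if_geometric_growth:
  assumes f: "f holomorphic_on UNIV" and K: "K > 1" and \<kappa>: "\<kappa> > 1"
    and growth: "\<forall>\<^sub>F r in at_top. \<kappa> * log_plus (max_modulus f r) \<le> log_plus (max_modulus f (K * r))"
    and pos: "\<forall>\<^sub>F r in at_top. log_plus (max_modulus f r) > 0"
  shows "growth_order f \<noteq> 0"
proof
  assume order0: "growth_order f = 0"
  define L where "L r = log_plus (max_modulus f r)" for r
  \<comment> \<open>Half the exponent forced by iteration: K^(n \<epsilon>) = \<kappa>^(n/2), which
    \<kappa>^n outgrows.\<close>
  define \<epsilon> where "\<epsilon> = ln \<kappa> / (2 * ln K)"
  have \<epsilon>: "\<epsilon> > 0" using K \<kappa> by (simp add: \<epsilon>_def)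
  have "\<forall>\<^sub>F r in at_top. r \<ge> 1 \<and> \<kappa> * L r \<le> L (K * r) \<and> L r > 0"
    using growth pos eventually_ge_at_top[of 1] unfolding L_def by eventually_elim auto
  then obtain r1 where r1: "\<And>r. r \<ge> r1 \<Longrightarrow> r \<ge> 1 \<and> \<kappa> * L r \<le> L (K * r) \<and> L r > 0"
    unfolding eventually_at_top_linorder by blast
  have r1': "r1 \<ge> 1" "L r1 > 0" using r1[of r1] by auto
  have iter: "\<kappa> ^ n * L r1 \<le> L (K ^ n * r1)" for n
  proof (induction n)
    case (Suc n)
    have "K ^ n * r1 \<ge> 1 * r1" using K r1' by (intro mult_right_mono one_le_power) auto
    then have "\<kappa> * L (K ^ n * r1) \<le> L (K ^ Suc n * r1)" using r1[of "K ^ n * r1"] by (simp add: mult_ac)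
    moreover have "\<kappa> * (\<kappa> ^ n * L r1) \<le> \<kappa> * L (K ^ n * r1)" using Suc \<kappa> by simp
    ultimately show ?case by (simp add: mult_ac)
  qed simp
  have "\<forall>\<^sub>F r in at_top. ereal (log_plus (nevanlinna_char f r) / ln r) < ereal \<epsilon>"
    using order0 \<epsilon> by (intro Limsup_lessD) (simp add: growth_order_def zero_ereal_def)
  then have T: "\<forall>\<^sub>F r in at_top. nevanlinna_char f r \<le> exp (\<epsilon> * ln r)"
    using eventually_gt_at_top[of 1]
  proof eventually_elim
    case (elim r)
    then have "ln (max 1 (nevanlinna_char f r)) \<le> \<epsilon> * ln r"
      by (simp add: log_plus_def divide_less_eq)
    then have "max 1 (nevanlinna_char f r) \<le> exp (\<epsilon> * ln r)"
      by (subst (asm) exp_le_cancel_iff[symmetric]) simp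
    then show ?case by simp
  qed
  define C where "C = 3 * exp (\<epsilon> * ln (2 * r1)) / L r1"
  \<comment> \<open>The characteristic is needed at twice the radius at which M is
    estimated.\<close>
  have "filterlim (\<lambda>n. K ^ n * (2 * r1)) at_top sequentially"
    using r1' by (intro filterlim_at_top_mult_tendsto_pos[OF tendsto_const] filterlim_power_at_top K) simp
  from eventually_compose_filterlim[OF T this]
  have "\<forall>\<^sub>F n in sequentially. exp (ln \<kappa> / 2) ^ n \<le> C"
  proof eventually_elim
    case (elim n)
    have "L (K ^ n * r1) \<le> 3 * nevanlinna_char f (2 * (K ^ n * r1))"
    proof -
      let ?B = "3 * nevanlinna_char f (2 * (K ^ n * r1))"
      have bd: "log_plus (cmod (f a)) \<le> ?B" if "cmod a \<le> K ^ n * r1" for a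
        by (rule log_plus_le_nevanlinna_char[OF f _ that]) (use K r1' in auto)
      have "cmod (f a) \<le> exp ?B" if "cmod a \<le> K ^ n * r1" for a
      proof -
        have "max 1 (cmod (f a)) \<le> exp ?B"
          using bd[OF that] unfolding log_plus_def
          by (subst (asm) exp_le_cancel_iff[symmetric]) simp
        then show ?thesis by simp
      qed
      then have "max_modulus f (K ^ n * r1) \<le> exp ?B"
        using K r1' by (intro max_modulus_least) auto
      \<comment> \<open>The bound at the origin gives this sign, so that exp ?B also dominates the 1
        in log^+.\<close>
      moreover have "0 \<le> ?B"
        using bd[of 0] log_plus_nonneg[of "cmod (f 0)"] K r1' by auto
      ultimately have "max 1 (max_modulus f (K ^ n * r1)) \<le> exp ?B" by simp
      then show ?thesis unfolding L_def log_plus_def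
        by (subst exp_le_cancel_iff[symmetric]) simp
    qed
    with iter[of n] elim have "\<kappa> ^ n * L r1 \<le> 3 * exp (\<epsilon> * ln (K ^ n * (2 * r1)))"
      by (simp add: mult_ac)
    also have "\<epsilon> * ln (K ^ n * (2 * r1)) = n * (ln \<kappa> / 2) + \<epsilon> * ln (2 * r1)"
      using K r1' by (simp add: ln_mult ln_realpow \<epsilon>_def field_simps)
    also have "3 * exp \<dots> = C * L r1 * exp (ln \<kappa> / 2) ^ n"
      using r1' by (simp only: C_def exp_add exp_of_nat_mult) simp
    finally have "\<kappa> ^ n \<le> C * exp (ln \<kappa> / 2) ^ n"
      using r1' by (simp add: mult_ac)
    \<comment> \<open>Cancelling one factor \<kappa>^(n/2) leaves an unbounded sequence bounded by
      \<open>C\<close>.\<close>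
    also have "\<kappa> ^ n = exp (ln \<kappa> / 2) ^ n * exp (ln \<kappa> / 2) ^ n"
      using \<kappa> by (simp flip: power_mult_distrib exp_add)
    finally show ?case by simp
  qed
  moreover have "\<forall>\<^sub>F n in sequentially. exp (ln \<kappa> / 2) ^ n > C"
    using \<kappa> filterlim_power_at_top[of "exp (ln \<kappa> / 2)"]
    by (simp add: filterlim_at_top_dense)
  ultimately have "\<forall>\<^sub>F n in sequentially. False" by eventually_elim simp
  then show False by simp
qed

text \<open>After taking logarithms the square root yields a factor 2 on log M(r); the factor r
  costs part of it, and 3/2 remains.\<close>

lemma growth_order_nonzero_if_max_modulus_le:
  assumes f: "transcendental_entire f" and K: "K > 1"
    and bound: "\<forall>\<^sub>F r in at_top. max_modulus f r \<le> 2 * r * sqrt (2 * max 1 (max_modulus f (K * r)))"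
  shows "growth_order f \<noteq> 0"
proof (rule growth_order_nonzero_if_geometric_growth[of f K "3/2"])
  \<comment> \<open>The error 3 ln 2 + 2 ln r is at most 5 ln r for r \<ge> 2. The power 10 makes
    this at most half of log^+ M(r).\<close>
  have large: "\<forall>\<^sub>F r in at_top. 10 * ln r \<le> log_plus (max_modulus f r)"
    using max_modulus_ge_power[OF f, of 10] eventually_gt_at_top[of 0]
  proof eventually_elim
    case (elim r)
    then have "r ^ 10 \<le> max 1 (max_modulus f r)" by simp
    then have "ln (r ^ 10) \<le> log_plus (max_modulus f r)"
      unfolding log_plus_def using elim by (intro ln_mono) auto
    then show ?case using elim by (simp add: ln_realpow)
  qed
  show "\<forall>\<^sub>F r in at_top. log_plus (max_modulus f r) > 0"
    using large eventually_gt_at_top[of 1]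
    by eventually_elim (smt (verit) ln_gt_zero)
  show "\<forall>\<^sub>F r in at_top. 3/2 * log_plus (max_modulus f r) \<le> log_plus (max_modulus f (K * r))"
    using large bound eventually_ge_at_top[of 2]
  proof eventually_elim
    case (elim r)
    define Y where "Y = max 1 (max_modulus f (K * r))"
    have Y: "Y \<ge> 1" by (simp add: Y_def)
    \<comment> \<open>Ensures that the right-hand side also bounds max 1 M(r).\<close>
    have "1 * 1 \<le> (2 * r) * sqrt (2 * Y)"
      using elim Y by (intro mult_mono) auto
    with elim have "log_plus (max_modulus f r) \<le> ln (2 * r * sqrt (2 * Y))"
      unfolding log_plus_def Y_def by (intro ln_mono) auto
    also have "\<dots> = ln 2 + ln r + (ln 2 + ln Y) / 2"
      using elim Y by (simp add: ln_mult ln_sqrt)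
    finally have "2 * log_plus (max_modulus f r) \<le> 3 * ln 2 + 2 * ln r + log_plus (max_modulus f (K * r))"
      by (simp add: log_plus_def Y_def field_simps)
    moreover have "ln 2 \<le> ln r" using elim by simp
    ultimately show ?case using elim(1) by linarith
  qed
qed (use f K in \<open>auto simp: transcendental_entire_def\<close>)

section \<open>Maximum modulus estimates from the functional equation\<close>

lemma le_sqrt_if_power_le:
  fixes x y :: real
  assumes "k \<ge> 2" "x ^ k \<le> y" "y \<ge> 1"
  shows "x \<le> sqrt y"
proof (cases "x \<ge> 1")
  case True
  then have "x ^ 2 \<le> y" using assms power_increasing[of 2 k x] by linarith
  then show ?thesis by (rule real_le_rsqrt)
next
  case False
  then show ?thesis using assms real_sqrt_ge_one[of y] by linarith
qed

text \<open>Every z equals q u + c with u = (z - c)/q, so w(z)^m = 1 - w'(u), and Cauchy's estimate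
  bounds w'(u).\<close>

lemma max_modulus_le_if_deriv_eq:
  assumes w: "w holomorphic_on UNIV" and q: "q \<noteq> 0" and m: "m \<ge> 2"
    and eq: "\<And>z. deriv w z + w (q * z + c) ^ m = 1"
  shows "\<forall>\<^sub>F r in at_top. max_modulus w r \<le>
    2 * r * sqrt (2 * max 1 (max_modulus w ((2 + 4 / cmod q) * r)))"
  using eventually_ge_at_top[of "max 1 (cmod c)"]
proof eventually_elim
  case (elim r)
  define Y where "Y = max 1 (max_modulus w ((2 + 4 / cmod q) * r))"
  have r: "r \<ge> 1" "r \<ge> cmod c" using elim by auto
  have "cmod (w z) \<le> 2 * r * sqrt (2 * Y)" if z: "cmod z \<le> r" for z
  proof -
    define u where "u = (z - c) / q"
    have "cmod (z - c) \<le> 2 * r" using z r norm_triangle_ineq4[of z c] by linarith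
    then have "cmod u \<le> 2 * r / cmod q"
      using q by (simp add: u_def norm_divide divide_right_mono)
    then have "cmod (deriv w u) \<le> max_modulus w (2 * r / cmod q + 1)"
      by (rule cmod_deriv_le_max_modulus[OF w])
    \<comment> \<open>As r \<ge> 1, the summand 2 absorbs the 1 from Cauchy's estimate; it also
      keeps the dilation factor above 1.\<close>
    also have "\<dots> \<le> max_modulus w ((2 + 4 / cmod q) * r)"
    proof (intro max_modulus_mono[OF w])
      have "0 \<le> r / cmod q" using r by simp
      moreover have "(2 + 4 / cmod q) * r = 2 * r + 4 * (r / cmod q)"
        by (simp add: distrib_right)
      moreover have "2 * r / cmod q = 2 * (r / cmod q)" by simp
      ultimately show "2 * r / cmod q + 1 \<le> (2 + 4 / cmod q) * r" "0 \<le> 2 * r / cmod q + 1"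
        using r by linarith+
    qed
    finally have du: "cmod (deriv w u) \<le> Y" by (simp add: Y_def)
    have "q * u + c = z" using q by (simp add: u_def)
    with eq[of u] have "w z ^ m = 1 - deriv w u"
      by (simp add: algebra_simps)
    then have "cmod (w z) ^ m = cmod (1 - deriv w u)"
      by (simp flip: norm_power)
    also have "\<dots> \<le> 1 + cmod (deriv w u)"
      using norm_triangle_ineq4[of 1 "deriv w u"] by simp
    also have "\<dots> \<le> 2 * Y" using du by (simp add: Y_def)
    finally have "cmod (w z) \<le> sqrt (2 * Y)"
      by (intro le_sqrt_if_power_le[OF m]) (auto simp: Y_def)
    \<comment> \<open>The factor 2r is inserted to match the other case, where integration produces
      it.\<close>
    also have "\<dots> \<le> 2 * r * sqrt (2 * Y)"
      using r mult_right_mono[of 1 "2 * r" "sqrt (2 * Y)"] by (simp add: Y_def)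
    finally show ?thesis .
  qed
  then show ?case unfolding Y_def using r by (intro max_modulus_least) auto
qed

text \<open>Here the equation bounds w' by the square root of a value of M, and the mean value
  inequality from 0 to z passes to w at the cost of a factor r.\<close>

lemma max_modulus_le_if_deriv_power_eq:
  assumes w: "w holomorphic_on UNIV" and n: "n \<ge> 2"
    and eq: "\<And>z. deriv w z ^ n + w (q * z + c) = 1"
  shows "\<forall>\<^sub>F r in at_top. max_modulus w r \<le>
    2 * r * sqrt (2 * max 1 (max_modulus w ((2 + cmod q + cmod c) * r)))"
  using eventually_ge_at_top[of "max 1 (cmod (w 0))"]
proof eventually_elim
  case (elim r)
  define Y where "Y = max 1 (max_modulus w ((2 + cmod q + cmod c) * r))"
  have r: "r \<ge> 1" "r \<ge> cmod (w 0)" using elim by auto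
  have deriv_le: "cmod (deriv w u) \<le> sqrt (2 * Y)" if u: "cmod u \<le> r" for u
  proof -
    have "cmod (q * u + c) \<le> cmod q * r + cmod c * r"
      using norm_triangle_ineq[of "q * u" c] mult_left_mono[OF u, of "cmod q"]
        mult_left_mono[OF r(1), of "cmod c"] by (simp add: norm_mult)
    also have "\<dots> \<le> (2 + cmod q + cmod c) * r" using r by (simp add: algebra_simps)
    finally have wu: "cmod (w (q * u + c)) \<le> Y"
      unfolding Y_def using cmod_le_max_modulus[OF w] by (simp add: le_max_iff_disj)
    have "deriv w u ^ n = 1 - w (q * u + c)"
      using eq[of u] by (simp add: algebra_simps)
    then have "cmod (deriv w u) ^ n = cmod (1 - w (q * u + c))"
      by (simp flip: norm_power)
    also have "\<dots> \<le> 1 + cmod (w (q * u + c))"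
      using norm_triangle_ineq4[of 1 "w (q * u + c)"] by simp
    also have "\<dots> \<le> 2 * Y" using wu by (simp add: Y_def)
    finally show ?thesis
      by (intro le_sqrt_if_power_le[OF n]) (auto simp: Y_def)
  qed
  have "cmod (w z) \<le> 2 * r * sqrt (2 * Y)" if z: "cmod z \<le> r" for z
  proof -
    have "cmod (w z - w 0) \<le> sqrt (2 * Y) * cmod (z - 0)"
    proof (rule field_differentiable_bound[of "cball 0 r" w "deriv w"])
      show "(w has_field_derivative deriv w x) (at x within cball 0 r)" for x
        using holomorphic_derivI[OF w, of x] by (auto intro: has_field_derivative_at_within)
    qed (use deriv_le z r in auto)
    also have "\<dots> \<le> sqrt (2 * Y) * r" using z by (intro mult_left_mono) (auto simp: Y_def)
    finally have "cmod (w z) \<le> cmod (w 0) + sqrt (2 * Y) * r"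
      using norm_triangle_ineq2[of "w z" "w 0"] by linarith
    \<comment> \<open>By the choice of r, |w 0| \<le> r; adding this term to the integrated bound
      gives the factor 2.\<close>
    also have "cmod (w 0) \<le> sqrt (2 * Y) * r"
    proof -
      have "1 \<le> sqrt (2 * Y)" by (intro real_sqrt_ge_one) (simp add: Y_def)
      then show ?thesis using r mult_right_mono[of 1 "sqrt (2 * Y)" r] by linarith
    qed
    finally show ?thesis by (simp add: mult_ac)
  qed
  then show ?case unfolding Y_def using r by (intro max_modulus_least) auto
qed

theorem theorem2p4:
  fixes m n :: nat and q c :: complex
  assumes "m > 0" and "n > 0" and "q \<noteq> 0"
    and "(m > n \<and> n = 1) \<or> (n > m \<and> m = 1)"
  shows "\<not> (\<exists>w :: complex \<Rightarrow> complex. transcendental_entire w \<and> growth_order w = 0 \<and>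
           (\<forall>z. deriv w z ^ n + w (q * z + c) ^ m = 1))"
proof
  assume "\<exists>w. transcendental_entire w \<and> growth_order w = 0 \<and>
           (\<forall>z. deriv w z ^ n + w (q * z + c) ^ m = 1)"
  then obtain w where w: "transcendental_entire w" and order: "growth_order w = 0"
    and eq: "\<And>z. deriv w z ^ n + w (q * z + c) ^ m = 1" by blast
  have hol: "w holomorphic_on UNIV" using w by (simp add: transcendental_entire_def)
  from assms(4) have "growth_order w \<noteq> 0"
  proof
    assume "m > n \<and> n = 1"
    then show ?thesis
      using growth_order_nonzero_if_max_modulus_le[OF w _ max_modulus_le_if_deriv_eq[OF hol assms(3), of m c]] eq
      by (simp add: add_pos_nonneg)
  next
    assume "n > m \<and> m = 1"
    then show ?thesis
      using growth_order_nonzero_if_max_modulus_le[OF w _ max_modulus_le_if_deriv_power_eq[OF hol, of n q c]] eq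
      by (simp add: add_pos_nonneg)
  qed
  with order show False by simp
qed

end
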